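(* Let $s\ge0$ be an integer and let $\phi$ be a CNF formula on $n$ variables with at most $2^s$ clauses. Then the number of isolated solutions of $\phi$ is at most $2^{\,n-n/(s+2)+1}$.
   Context: A CNF formula is an AND of clauses (ORs of literals). An assignment $x\in\{0,1\}^n$ is an isolated solution of $\phi$ if $\phi(x)=1$ and $\phi(y)=0$ for every $y\in\{0,1\}^n$ differing from $x$ in exactly one coordinate. *)

theory Defs
  imports Complex_Main
begin

datatype literal = Pos nat | Neg nat

fun var_of :: "literal \<Rightarrow> nat" where
  "var_of (Pos i) = i"
| "var_of (Neg i) = i"

text \<open>A clause is the set of its literals (read as their OR) and a CNF formula is the set of
  its clauses (read as their AND). The empty clause is false and the empty formula is true.\<close>

type_synonym clause = "literal set"
type_synonym cnf = "clause set"

text \<open>The variables are numbered \<open>0, \<dots>, n - 1\<close>; they need not all occur in the formula.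
  Clauses and formulas satisfying this predicate are automatically finite.\<close>

definition cnf_on :: "nat \<Rightarrow> cnf \<Rightarrow> bool" where
  "cnf_on n \<phi> \<longleftrightarrow> (\<forall>C\<in>\<phi>. \<forall>l\<in>C. var_of l < n)"

definition cube :: "nat \<Rightarrow> bool list set" where
  "cube n = {x. length x = n}"

fun eval_literal :: "bool list \<Rightarrow> literal \<Rightarrow> bool" where
  "eval_literal x (Pos i) \<longleftrightarrow> x ! i"
| "eval_literal x (Neg i) \<longleftrightarrow> \<not> x ! i"

definition eval_clause :: "bool list \<Rightarrow> clause \<Rightarrow> bool" where
  "eval_clause x C \<longleftrightarrow> (\<exists>l\<in>C. eval_literal x l)"

definition eval_cnf :: "bool list \<Rightarrow> cnf \<Rightarrow> bool" where
  "eval_cnf x \<phi> \<longleftrightarrow> (\<forall>C\<in>\<phi>. eval_clause x C)"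

definition isolated_solutions :: "nat \<Rightarrow> cnf \<Rightarrow> bool list set" where
  "isolated_solutions n \<phi> =
    {x \<in> cube n. eval_cnf x \<phi> \<and>
      (\<forall>y\<in>cube n. card {i. i < n \<and> x ! i \<noteq> y ! i} = 1 \<longrightarrow> \<not> eval_cnf y \<phi>)}"

end

theory Submission
  imports Defs
begin

text \<open>Put \<open>k = s + 2\<close>. If every clause has at most \<open>k\<close> variables, then every isolated
  solution \<open>x\<close> has, for every variable \<open>i\<close>, a clause whose only true literal at \<open>x\<close> is the one
  on \<open>i\<close>, so the value of \<open>x\<close> at \<open>i\<close> can be recovered from the at most \<open>k - 1\<close> other variables
  of that clause; revealing the variables in random order saves \<open>n / k\<close> bits on average, and
  there are at most \<open>2 ^ (n - n / k)\<close> isolated solutions (Paturi, Pudlak, Zane). In general,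
  shorten every clause with more than \<open>k\<close> variables to \<open>k\<close> of its literals. The isolated
  solutions that satisfy all shortened clauses are isolated solutions of the shortened formula.
  The others falsify \<open>k\<close> given literals, hence lie in one of at most \<open>2 ^ s\<close> subcubes of
  dimension \<open>n - k\<close>; by induction these contain at most
  \<open>2 ^ s * 2 ^ (n - k - (n - k) / k + 1) = 2 ^ (n - n / k)\<close> isolated solutions.\<close>

subsection \<open>The satisfiability coding lemma\<close>

text \<open>Convexity: each \<open>2 powr t v\<close> lies above the tangent at the mean
  \<open>m\<close>, and the linear terms cancel when summed over \<open>V\<close>.\<close>

lemma jensen_powr_two:
  fixes t :: "'a \<Rightarrow> real"
  assumes m: "(\<Sum>v\<in>V. t v) = real (card V) * m"
  shows "real (card V) * 2 powr m \<le> (\<Sum>v\<in>V. 2 powr t v)"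
proof -
  have tangent: "2 powr m * (1 + (t v - m) * ln 2) \<le> 2 powr t v" for v
  proof -
    have "2 powr t v = 2 powr m * exp ((t v - m) * ln 2)"
      by (simp add: powr_def algebra_simps flip: exp_add)
    then show ?thesis
      using exp_ge_add_one_self[of "(t v - m) * ln 2"] by (simp add: mult_left_mono)
  qed
  have "(\<Sum>v\<in>V. 2 powr m * (1 + (t v - m) * ln 2)) =
      2 powr m * (real (card V) + ((\<Sum>v\<in>V. t v) - real (card V) * m) * ln 2)"
    by (simp add: sum.distrib sum_subtractf flip: sum_distrib_left sum_distrib_right)
  also have "\<dots> = real (card V) * 2 powr m" by (simp add: m)
  finally have "real (card V) * 2 powr m = (\<Sum>v\<in>V. 2 powr m * (1 + (t v - m) * ln 2))" by simp
  also have "\<dots> \<le> (\<Sum>v\<in>V. 2 powr t v)" by (intro sum_mono tangent)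
  finally show ?thesis .
qed

text \<open>Deleting the other elements of \<open>S\<close> one at a time contributes 1 in total,
  and each element outside \<open>S\<close> contributes \<open>1 / card S\<close>. Hence averaging
  over the first revealed variable loses nothing.\<close>

lemma sum_inverse_card_delete:
  fixes V :: "'a set"
  assumes "finite V" "S \<subseteq> V" "i \<in> S" "card S \<ge> 2"
  shows "(\<Sum>v\<in>V - {i}. 1 / real (card (S - {v}))) = real (card V) / real (card S)"
proof -
  have fS: "finite S" using assms finite_subset by blast
  have V: "V - {i} = (S - {i}) \<union> (V - S)" using assms by auto
  have "(\<Sum>v\<in>V - {i}. 1 / real (card (S - {v}))) =
      (\<Sum>v\<in>S - {i}. 1 / real (card (S - {v}))) + (\<Sum>v\<in>V - S. 1 / real (card (S - {v})))"
    unfolding V using assms fS by (intro sum.union_disjoint) auto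
  also have "(\<Sum>v\<in>S - {i}. 1 / real (card (S - {v}))) = (\<Sum>v\<in>S - {i}. 1 / (real (card S) - 1))"
    using assms fS by (intro sum.cong) (auto simp: of_nat_diff)
  also have "\<dots> = 1" using assms fS by simp
  also have "(\<Sum>v\<in>V - S. 1 / real (card (S - {v}))) = (\<Sum>v\<in>V - S. 1 / real (card S))"
    by (intro sum.cong) auto
  also have "\<dots> = (real (card V) - real (card S)) / real (card S)"
    using assms fS by (simp add: card_Diff_subset card_mono)
  finally show ?thesis using assms by (simp add: field_simps)
qed

text \<open>\<open>b x i\<close> is the value of the assignment \<open>x\<close> at the variable \<open>i\<close>, and \<open>D x i\<close> is the set
  of variables of a clause that forces this value. The sum on the left is the Kraft sum of the
  code words in which the variables are revealed in random order.\<close>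

lemma coding_kraft:
  fixes b :: "'x \<Rightarrow> 'a \<Rightarrow> bool" and D :: "'x \<Rightarrow> 'a \<Rightarrow> 'a set"
  assumes "finite V" "finite A"
    and inj: "\<And>x y. x \<in> A \<Longrightarrow> y \<in> A \<Longrightarrow> (\<And>i. i \<in> V \<Longrightarrow> b x i = b y i) \<Longrightarrow> x = y"
    and D: "\<And>x i. x \<in> A \<Longrightarrow> i \<in> V \<Longrightarrow> i \<in> D x i" "\<And>x i. x \<in> A \<Longrightarrow> i \<in> V \<Longrightarrow> D x i \<subseteq> V"
    and force: "\<And>x y i. x \<in> A \<Longrightarrow> y \<in> A \<Longrightarrow> i \<in> V \<Longrightarrow>
      (\<And>j. j \<in> D x i - {i} \<Longrightarrow> b y j = b x j) \<Longrightarrow> b y i = b x i"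
  shows "(\<Sum>x\<in>A. 2 powr (\<Sum>i\<in>V. 1 / real (card (D x i)))) \<le> 2 ^ card V"
  using assms
proof (induction "card V" arbitrary: V A D)
  case 0
  have "V = {}" using 0(1,2) by simp
  then have "x = y" if "x \<in> A" "y \<in> A" for x y using 0(4)[OF that] by blast
  then have "card A \<le> 1" using \<open>finite A\<close> by (simp add: card_le_Suc0_iff_eq)
  then show ?case using \<open>V = {}\<close> by simp
next
  case (Suc d)
  note fin = Suc.prems(1,2) and inj = Suc.prems(3) and D = Suc.prems(4,5)
    and force = Suc.prems(6)
  let ?e = "\<lambda>x v. \<Sum>i\<in>V - {v}. 1 / real (card (D x i - {v}))"
  have half: "(\<Sum>x\<in>{x\<in>A. b x v = c}. 2 powr ?e x v) \<le> 2 ^ d" if v: "v \<in> V" for v c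
  proof -
    have card: "d = card (V - {v})" using v Suc.hyps(2) fin by simp
    have "(\<Sum>x\<in>{x\<in>A. b x v = c}. 2 powr ?e x v) \<le> 2 ^ card (V - {v})"
    proof (rule Suc.hyps(1)[OF card])
      fix x y assume xy: "x \<in> {x\<in>A. b x v = c}" "y \<in> {x\<in>A. b x v = c}"
        and eq: "\<And>i. i \<in> V - {v} \<Longrightarrow> b x i = b y i"
      have "b x i = b y i" if "i \<in> V" for i using xy eq[of i] that by (cases "i = v") auto
      then show "x = y" using xy inj[of x y] by simp
    next
      fix x y i assume xy: "x \<in> {x\<in>A. b x v = c}" "y \<in> {x\<in>A. b x v = c}" and i: "i \<in> V - {v}"
        and eq: "\<And>j. j \<in> D x i - {v} - {i} \<Longrightarrow> b y j = b x j"
      have "b y j = b x j" if "j \<in> D x i - {i}" for j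
        using xy eq[of j] that by (cases "j = v") auto
      then show "b y i = b x i" using xy i force[of x y i] by simp
    qed (use fin D in \<open>auto intro: subsetD[OF D(2)]\<close>)
    with card show ?thesis by simp
  qed
  have le: "(\<Sum>i\<in>V. 1 / real (card (D x i))) \<le> 1 / real (card (D x v)) + ?e x v"
    if "x \<in> A" "v \<in> V" for x v
  proof -
    have "(\<Sum>i\<in>V - {v}. 1 / real (card (D x i))) \<le> ?e x v"
    proof (rule sum_mono)
      fix i assume i: "i \<in> V - {v}"
      have f: "finite (D x i)" using D(2)[OF \<open>x \<in> A\<close>] i fin finite_subset by blast
      have "i \<in> D x i - {v}" using D(1)[OF \<open>x \<in> A\<close>] i by auto
      then have "0 < card (D x i - {v})" using f card_gt_0_iff by blast
      moreover have "card (D x i - {v}) \<le> card (D x i)" using f by (simp add: card_mono)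
      ultimately show "1 / real (card (D x i)) \<le> 1 / real (card (D x i - {v}))"
        by (simp add: frac_le)
    qed
    then show ?thesis using fin that by (simp add: sum.remove[of V v])
  qed
  \<comment> \<open>A singleton \<open>D x v\<close> makes \<open>v\<close> constant on
    \<open>A\<close>, so one half is all of \<open>A\<close> and the spare factor 2 pays for the
    term of \<open>v\<close>. Otherwise all forcing sets have at least two elements and one averages
    over \<open>v\<close>.\<close>
  show ?case
  proof (cases "\<exists>x\<in>A. \<exists>v\<in>V. card (D x v) = 1")
    case True
    then obtain x v where xv: "x \<in> A" "v \<in> V" "card (D x v) = 1" by blast
    have "D x v = {v}" using xv D(1)[of x v] by (metis card_1_singletonE singletonD)
    then have const: "b y v = b x v" if "y \<in> A" for y using force[of x y v] xv that by auto
    have "2 powr (\<Sum>i\<in>V. 1 / real (card (D y i))) \<le> 2 * 2 powr ?e y v" if "y \<in> A" for y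
    proof -
      have "1 / real (card (D y v)) \<le> 1" by (cases "card (D y v)") auto
      then have "2 powr (\<Sum>i\<in>V. 1 / real (card (D y i))) \<le> 2 powr (1 + ?e y v)"
        using le[OF that \<open>v \<in> V\<close>] by (intro powr_mono) auto
      then show ?thesis by (simp add: powr_add)
    qed
    then have "(\<Sum>y\<in>A. 2 powr (\<Sum>i\<in>V. 1 / real (card (D y i)))) \<le> 2 * (\<Sum>y\<in>A. 2 powr ?e y v)"
      unfolding sum_distrib_left by (rule sum_mono)
    moreover have "{y\<in>A. b y v = b x v} = A" using const by blast
    ultimately show ?thesis using half[OF \<open>v \<in> V\<close>, of "b x v"] Suc.hyps(2)[symmetric] by simp
  next
    case False
    have two: "card (D x i) \<ge> 2" if "x \<in> A" "i \<in> V" for x i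
    proof -
      have "card (D x i) \<noteq> 0"
        using D[OF that] fin by (metis card_0_eq empty_iff finite_subset)
      moreover have "card (D x i) \<noteq> 1" using False that by blast
      ultimately show ?thesis by linarith
    qed
    \<comment> \<open>The mean of \<open>?e x v\<close> over \<open>v\<close> is the full exponent
      of \<open>x\<close>, as Jensen requires.\<close>
    have "(\<Sum>v\<in>V. ?e x v) = real (card V) * (\<Sum>i\<in>V. 1 / real (card (D x i)))" if "x \<in> A" for x
    proof -
      have "(\<Sum>v\<in>V. ?e x v) = (\<Sum>v\<in>V. \<Sum>i | i \<in> V \<and> v \<noteq> i. 1 / real (card (D x i - {v})))"
        by (intro sum.cong refl) auto
      also have "\<dots> = (\<Sum>i\<in>V. \<Sum>v | v \<in> V \<and> v \<noteq> i. 1 / real (card (D x i - {v})))"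
        using fin by (intro sum.swap_restrict) auto
      also have "\<dots> = (\<Sum>i\<in>V. \<Sum>v\<in>V - {i}. 1 / real (card (D x i - {v})))"
        by (intro sum.cong refl) auto
      also have "\<dots> = (\<Sum>i\<in>V. real (card V) / real (card (D x i)))"
        using that fin D two by (intro sum.cong refl sum_inverse_card_delete) auto
      finally show ?thesis by (simp add: sum_distrib_left)
    qed
    then have "real (card V) * 2 powr (\<Sum>i\<in>V. 1 / real (card (D x i))) \<le> (\<Sum>v\<in>V. 2 powr ?e x v)"
      if "x \<in> A" for x
      using that by (intro jensen_powr_two) auto
    then have "real (card V) * (\<Sum>x\<in>A. 2 powr (\<Sum>i\<in>V. 1 / real (card (D x i))))
        \<le> (\<Sum>x\<in>A. \<Sum>v\<in>V. 2 powr ?e x v)"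
      unfolding sum_distrib_left by (rule sum_mono)
    also have "\<dots> = (\<Sum>v\<in>V. \<Sum>x\<in>A. 2 powr ?e x v)" by (rule sum.swap)
    also have "\<dots> \<le> (\<Sum>v\<in>V. 2 ^ card V)"
    proof (rule sum_mono)
      fix v assume v: "v \<in> V"
      have "A = {x\<in>A. b x v = True} \<union> {x\<in>A. b x v = False}" by auto
      then have "(\<Sum>x\<in>A. 2 powr ?e x v) = (\<Sum>x\<in>{x\<in>A. b x v = True}. 2 powr ?e x v)
          + (\<Sum>x\<in>{x\<in>A. b x v = False}. 2 powr ?e x v)"
        using fin by (subst sum.union_disjoint[symmetric]) auto
      then show "(\<Sum>x\<in>A. 2 powr ?e x v) \<le> 2 ^ card V"
        using half[OF v, of True] half[OF v, of False] Suc.hyps(2)[symmetric] by simp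
    qed
    finally show ?thesis using Suc.hyps(2)[symmetric] by simp
  qed
qed

text \<open>Under the width bound every term of the Kraft sum is at least
  \<open>2 powr (card V / k)\<close>.\<close>

lemma coding_lemma:
  fixes b :: "'x \<Rightarrow> 'a \<Rightarrow> bool" and D :: "'x \<Rightarrow> 'a \<Rightarrow> 'a set"
  assumes "finite V" "finite A"
    and inj: "\<And>x y. x \<in> A \<Longrightarrow> y \<in> A \<Longrightarrow> (\<And>i. i \<in> V \<Longrightarrow> b x i = b y i) \<Longrightarrow> x = y"
    and D: "\<And>x i. x \<in> A \<Longrightarrow> i \<in> V \<Longrightarrow> i \<in> D x i" "\<And>x i. x \<in> A \<Longrightarrow> i \<in> V \<Longrightarrow> D x i \<subseteq> V"
    and force: "\<And>x y i. x \<in> A \<Longrightarrow> y \<in> A \<Longrightarrow> i \<in> V \<Longrightarrow>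
      (\<And>j. j \<in> D x i - {i} \<Longrightarrow> b y j = b x j) \<Longrightarrow> b y i = b x i"
    and width: "\<And>x i. x \<in> A \<Longrightarrow> i \<in> V \<Longrightarrow> card (D x i) \<le> k"
  shows "real (card A) \<le> 2 powr (real (card V) - real (card V) / real k)"
proof -
  have "2 powr (real (card V) / real k) \<le> 2 powr (\<Sum>i\<in>V. 1 / real (card (D x i)))"
    if "x \<in> A" for x
  proof -
    have "(\<Sum>i\<in>V. 1 / real k) \<le> (\<Sum>i\<in>V. 1 / real (card (D x i)))"
    proof (rule sum_mono)
      fix i assume i: "i \<in> V"
      have "0 < card (D x i)"
        using D[OF that i] assms(1) by (metis card_gt_0_iff empty_iff finite_subset)
      then show "1 / real k \<le> 1 / real (card (D x i))"
        using width[OF that i] by (simp add: frac_le)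
    qed
    then show ?thesis by simp
  qed
  then have "real (card A) * 2 powr (real (card V) / real k)
      \<le> (\<Sum>x\<in>A. 2 powr (\<Sum>i\<in>V. 1 / real (card (D x i))))"
    using sum_mono[of A "\<lambda>_. 2 powr (real (card V) / real k)"] by simp
  also have "\<dots> \<le> 2 ^ card V" by (rule coding_kraft[where b = b, OF assms(1-6)])
  finally show ?thesis by (simp add: powr_diff powr_realpow field_simps)
qed

subsection \<open>Shortening the long clauses\<close>

lemma eval_literal_cong:
  "x ! var_of l = y ! var_of l \<Longrightarrow> eval_literal x l \<longleftrightarrow> eval_literal y l"
  by (cases l) auto

lemma eval_literal_inj:
  "eval_literal x l \<Longrightarrow> eval_literal y l \<Longrightarrow> x ! var_of l = y ! var_of l"
  by (cases l) auto

lemma eval_literal_flip: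
  "var_of l < length x \<Longrightarrow>
    eval_literal (x[i := \<not> x ! i]) l \<longleftrightarrow> (eval_literal x l \<noteq> (var_of l = i))"
  by (cases l; cases "var_of l = i") auto

lemma finite_cnf_on:
  assumes "cnf_on n \<phi>" shows "finite \<phi>"
proof -
  have "l \<in> Pos ` {..<n} \<union> Neg ` {..<n}" if "var_of l < n" for l
    using that by (cases l) auto
  then have "\<phi> \<subseteq> Pow (Pos ` {..<n} \<union> Neg ` {..<n})"
    using assms unfolding cnf_on_def by blast
  then show ?thesis by (rule finite_subset) auto
qed

lemma finite_cube: "finite (cube n)"
  using finite_lists_length_eq[of "UNIV :: bool set" n] by (simp add: cube_def)

text \<open>Some clause fails after flipping \<open>i\<close>. The flip changes only literals on
  \<open>i\<close>, so in that clause these are true at \<open>x\<close> and all others are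
  false.\<close>

lemma isolated_critical_clause:
  assumes "cnf_on n \<phi>" "x \<in> isolated_solutions n \<phi>" "i < n"
  shows "\<exists>C\<in>\<phi>. \<forall>l\<in>C. eval_literal x l \<longleftrightarrow> var_of l = i"
proof -
  let ?y = "x[i := \<not> x ! i]"
  have len: "length x = n" using assms(2) by (simp add: isolated_solutions_def cube_def)
  have "{j. j < n \<and> x ! j \<noteq> ?y ! j} = {i}" using assms(3) len by (auto simp: nth_list_update)
  then have "\<not> eval_cnf ?y \<phi>"
    using assms(2) len unfolding isolated_solutions_def cube_def by auto
  then obtain C where C: "C \<in> \<phi>" "\<forall>l\<in>C. \<not> eval_literal ?y l"
    unfolding eval_cnf_def eval_clause_def by blast
  then show ?thesis using assms(1) len unfolding cnf_on_def by (metis eval_literal_flip)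
qed

text \<open>The induction passes to subcubes without restricting the formula: \<open>A\<close> lives in a subcube
  with free variables \<open>V\<close>, and only isolation in the directions of \<open>V\<close> is required.\<close>

lemma card_isolated_subcube:
  fixes s n :: nat
  assumes cnf: "cnf_on n \<phi>" and card: "card \<phi> \<le> 2 ^ s"
    and "V \<subseteq> {..<n}" "A \<subseteq> cube n"
    and "\<And>x y i. x \<in> A \<Longrightarrow> y \<in> A \<Longrightarrow> i < n \<Longrightarrow> i \<notin> V \<Longrightarrow> x ! i = y ! i"
    and "\<And>x. x \<in> A \<Longrightarrow> eval_cnf x \<phi>"
    and "\<And>x i. x \<in> A \<Longrightarrow> i \<in> V \<Longrightarrow> \<exists>C\<in>\<phi>. \<forall>l\<in>C. eval_literal x l \<longleftrightarrow> var_of l = i"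
  shows "real (card A) \<le> 2 powr (real (card V) - real (card V) / (real s + 2) + 1)"
  using assms(3-)
proof (induction "card V" arbitrary: V A rule: less_induct)
  case less
  note V = less.prems(1) and A = less.prems(2) and out = less.prems(3)
    and sol = less.prems(4) and crit = less.prems(5)
  \<comment> \<open>\<open>?M\<close> is half of the claimed bound: it bounds \<open>B\<close>, and
    also all the \<open>F C\<close> together.\<close>
  let ?k = "s + 2" and ?M = "2 powr (real (card V) - real (card V) / (real s + 2))"
  have fV: "finite V" using V finite_subset by blast
  have fA: "finite A" using A finite_cube finite_subset by blast
  have fphi: "finite \<phi>" using cnf by (rule finite_cnf_on)
  \<comment> \<open>Width counts only free variables, since literals outside \<open>V\<close> are
    constant on \<open>A\<close>.\<close>
  define L where "L = {C\<in>\<phi>. ?k < card (var_of ` C \<inter> V)}"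
  have "\<exists>T\<subseteq>C. var_of ` T \<subseteq> V \<and> card (var_of ` T) = ?k" if "C \<in> L" for C
  proof -
    have "?k \<le> card (var_of ` C \<inter> V)" using that by (simp add: L_def)
    then obtain S where S: "S \<subseteq> var_of ` C \<inter> V" "card S = ?k"
      by (meson obtain_subset_with_card_n)
    then obtain T where "T \<subseteq> C" "S = var_of ` T" by (meson le_inf_iff subset_imageE)
    with S show ?thesis by blast
  qed
  then obtain T where T: "\<And>C. C \<in> L \<Longrightarrow> T C \<subseteq> C \<and> var_of ` T C \<subseteq> V \<and> card (var_of ` T C) = ?k"
    by metis
  define B where "B = {x\<in>A. \<forall>C\<in>L. eval_clause x (T C)}"
  define F where "F C = {x\<in>A. \<not> eval_clause x (T C)}" for C

  \<comment> \<open>On \<open>F C\<close> all literals of \<open>T C\<close> are false, which fixes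
    \<open>?k\<close> further variables, so induction applies to a smaller subcube.\<close>
  have F: "2 ^ s * real (card (F C)) \<le> ?M" if C: "C \<in> L" for C
  proof -
    let ?W = "V - var_of ` T C"
    have le: "?k \<le> card V" using T[OF C] fV by (metis card_mono)
    have cW: "card ?W = card V - ?k"
      using T[OF C] fV by (metis card_Diff_subset finite_subset)
    have "real (card (F C)) \<le> 2 powr (real (card ?W) - real (card ?W) / (real s + 2) + 1)"
    proof (rule less.hyps)
      show "card ?W < card V" using cW le by simp
      fix x y i assume xy: "x \<in> F C" "y \<in> F C" and i: "i < n" "i \<notin> ?W"
      show "x ! i = y ! i"
      proof (cases "i \<in> V")
        case True
        then obtain l where l: "l \<in> T C" "i = var_of l" using i by blast
        then have "\<not> eval_literal x l" "\<not> eval_literal y l"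
          using xy unfolding F_def eval_clause_def by auto
        then show ?thesis using l by (cases l) auto
      qed (use xy i out in \<open>auto simp: F_def\<close>)
    qed (use V A sol crit in \<open>auto simp: F_def\<close>)
    \<comment> \<open>Losing \<open>s + 2\<close> dimensions lowers the quotient by 1; with the
      \<open>+ 1\<close> of the bound this leaves a net drop of \<open>s\<close>, enough to sum over
      \<open>2 ^ s\<close> clauses.\<close>
    also have "real (card ?W) - real (card ?W) / (real s + 2) + 1 =
        (real (card V) - real (card V) / (real s + 2)) - real s"
      using le by (simp add: cW of_nat_diff field_simps)
    also have "2 powr \<dots> = ?M / 2 ^ s" by (simp add: powr_diff powr_realpow)
    finally show ?thesis by (simp add: pos_le_divide_eq mult.commute)
  qed

  have B: "real (card B) \<le> 2 powr (real (card V) - real (card V) / real ?k)"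
  proof -
    \<comment> \<open>Short clauses only lose their literals outside \<open>V\<close>, so the
      shortened formula lives on \<open>V\<close> and has width at most \<open>?k\<close>.\<close>
    define R where "R C = (if C \<in> L then T C else {l\<in>C. var_of l \<in> V})" for C
    have R: "R C \<subseteq> C" "var_of ` R C \<subseteq> V" for C using T[of C] by (auto simp: R_def)
    have width: "card (var_of ` R C) \<le> ?k" if "C \<in> \<phi>" for C
    proof (cases "C \<in> L")
      case False
      have "var_of ` {l\<in>C. var_of l \<in> V} = var_of ` C \<inter> V" by auto
      with False that show ?thesis by (simp add: R_def L_def)
    qed (use T in \<open>simp add: R_def\<close>)
    obtain K where K: "\<And>x i. x \<in> A \<Longrightarrow> i \<in> V \<Longrightarrow>
        K x i \<in> \<phi> \<and> (\<forall>l\<in>K x i. eval_literal x l \<longleftrightarrow> var_of l = i)"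
      using crit by metis
    text \<open>A literal on a variable outside \<open>V\<close> has the same value throughout \<open>A\<close>, so it cannot
      be the one that satisfies the critical clause.\<close>
    have true: "\<exists>l\<in>R (K x i). eval_literal y l" if x: "x \<in> B" and y: "y \<in> B" and i: "i \<in> V" for x y i
    proof (cases "K x i \<in> L")
      case True
      then show ?thesis using y by (auto simp: B_def R_def eval_clause_def)
    next
      case False
      have xy: "x \<in> A" "y \<in> A" using x y by (auto simp: B_def)
      note K = K[OF xy(1) i]
      then obtain l where l: "l \<in> K x i" "eval_literal y l"
        using sol[OF xy(2)] unfolding eval_cnf_def eval_clause_def by blast
      have "var_of l \<in> V"
      proof (rule ccontr)
        assume nV: "var_of l \<notin> V"
        have "var_of l < n" using cnf K l(1) unfolding cnf_on_def by blast
        then have "eval_literal x l"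
          using l(2) out[OF xy _ nV] eval_literal_cong by blast
        then have "var_of l = i" using K l(1) by blast
        then show False using nV i by simp
      qed
      then show ?thesis using l False by (auto simp: R_def)
    qed
    show ?thesis
    proof (rule coding_lemma[where b = "(!)" and D = "\<lambda>x i. var_of ` R (K x i)"])
      show "finite B" using fA by (simp add: B_def)
      fix x i assume x: "x \<in> B" and i: "i \<in> V"
      then have xA: "x \<in> A" by (simp add: B_def)
      have KR: "eval_literal x l \<longleftrightarrow> var_of l = i" if "l \<in> R (K x i)" for l
        using K[OF xA i] R(1) that by blast
      show "card (var_of ` R (K x i)) \<le> ?k" using width K[OF xA i] by blast
      show "i \<in> var_of ` R (K x i)" using true[OF x x i] KR by auto
      fix y assume y: "y \<in> B" and agree: "\<And>j. j \<in> var_of ` R (K x i) - {i} \<Longrightarrow> y ! j = x ! j"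
      \<comment> \<open>A literal of \<open>R (K x i)\<close> true at \<open>y\<close> must be on
        \<open>i\<close>: on its other variables \<open>y\<close> agrees with \<open>x\<close>,
        where only literals on \<open>i\<close> are true.\<close>
      obtain l where l: "l \<in> R (K x i)" "eval_literal y l" using true[OF x y i] by blast
      have "var_of l = i"
        using agree[of "var_of l"] l KR[OF l(1)] eval_literal_cong[of y l x] by auto
      then show "y ! i = x ! i" using l KR[OF l(1)] eval_literal_inj[of y l x] by simp
    next
      fix x y assume xy: "x \<in> B" "y \<in> B" and eq: "\<And>i. i \<in> V \<Longrightarrow> x ! i = y ! i"
      then have xyA: "x \<in> A" "y \<in> A" by (auto simp: B_def)
      then have len: "length x = n" "length y = n" using A by (auto simp: cube_def)
      show "x = y"
      proof (rule nth_equalityI)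
        fix i assume "i < length x"
        then show "x ! i = y ! i" using eq[of i] out[OF xyA, of i] len by blast
      qed (simp add: len)
    qed (use fV R in auto)
  qed

  have "A = B \<union> (\<Union>C\<in>L. F C)" by (auto simp: B_def F_def)
  then have "card A \<le> card B + card (\<Union>C\<in>L. F C)" by (metis card_Un_le)
  moreover have "card (\<Union>C\<in>L. F C) \<le> (\<Sum>C\<in>L. card (F C))"
    using fphi by (intro card_UN_le) (simp add: L_def)
  ultimately have "real (card A) \<le> real (card B) + (\<Sum>C\<in>L. real (card (F C)))"
    by (simp flip: of_nat_sum of_nat_add)
  also have "(\<Sum>C\<in>L. real (card (F C))) \<le> (\<Sum>C\<in>L. ?M / 2 ^ s)"
    using F by (intro sum_mono) (simp add: field_simps)
  also have "\<dots> \<le> 2 ^ s * (?M / 2 ^ s)"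
  proof -
    have "card L \<le> card \<phi>" using fphi by (intro card_mono) (auto simp: L_def)
    then have "card L \<le> 2 ^ s" using card by simp
    then have "real (card L) \<le> 2 ^ s" by (metis of_nat_le_iff of_nat_numeral of_nat_power)
    then show ?thesis unfolding sum_constant by (intro mult_right_mono) auto
  qed
  finally show ?case using B by (simp add: powr_add add.commute)
qed

theorem theorem6p2:
  fixes s n :: nat and \<phi> :: cnf
  assumes "cnf_on n \<phi>"
    and "card \<phi> \<le> 2 ^ s"
  shows "real (card (isolated_solutions n \<phi>)) \<le> 2 powr (real n - real n / (real s + 2) + 1)"
proof -
  have "real (card (isolated_solutions n \<phi>))
      \<le> 2 powr (real (card {..<n}) - real (card {..<n}) / (real s + 2) + 1)"
    using isolated_critical_clause[OF assms(1)]
    by (intro card_isolated_subcube[OF assms]) (auto simp: isolated_solutions_def)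
  then show ?thesis by simp
qed

end
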